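(* Let $p$ be a prime with $p\equiv 1\pmod 3$ and write $p=3h+1$. Define polynomials in an indeterminate $y$ by $$A=A_p(y)=\sum_{j=0}^{h}y^{3j},\qquad B=B_p(y)=y^2\sum_{j=0}^{h-1}y^{3j},\qquad C=C_p(y)=y\sum_{j=0}^{h-1}y^{3j},$$ and the matrix $$T_p(y)=\begin{pmatrix}A&B&C\\ C&A&B\\ B&C&A\end{pmatrix}.$$ Let $v(y)=(1,y,y^2)^t$ and $e_0=(1,0,0)^t$. Then for every integer $k\ge 0$, $$F_{p,k}(y):=e_0^t\,T_p(y)^k\,v(y)=\sum_{0\le n<p^k}y^{s_p(3n)},$$ and, as formal power series in $z$, $$\sum_{k\ge 0}F_{p,k}(y)z^k=\frac{(1-z)^2}{\det(I-zT_p(y))}.$$ Moreover, $$\det(I-zT_p(y))=\bigl(1-z(A+B+C)\bigr)\bigl(1-z(2A-B-C)+z^2(A^2+B^2+C^2-AB-AC-BC)\bigr).$$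
   Context: For an integer $m\ge 0$, $s_p(m)$ denotes the sum of the digits of $m$ in base $p$. $I$ is the $3\times 3$ identity matrix and ${}^t$ denotes transpose. *)

theory Defs
  imports
    "HOL-Computational_Algebra.Primes"
    "HOL-Computational_Algebra.Formal_Power_Series"
    "HOL-Number_Theory.Cong"
    "Jordan_Normal_Form.Determinant"
begin

(* For b < 2 there is no base-b expansion; the value 0 only makes the recursion terminate. *)
fun digit_sum :: "nat \<Rightarrow> nat \<Rightarrow> nat" where
  "digit_sum b m = (if b < 2 \<or> m = 0 then 0 else m mod b + digit_sum b (m div b))"

declare digit_sum.simps [simp del]

abbreviation indet_y :: "int poly" where
  "indet_y \<equiv> [:0, 1:]"

(* The polynomials and matrices are indexed by h rather than by p = 3 h + 1. *)

definition poly_A :: "nat \<Rightarrow> int poly" where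
  "poly_A h = (\<Sum>j=0..h. indet_y ^ (3 * j))"

definition poly_B :: "nat \<Rightarrow> int poly" where
  "poly_B h = indet_y ^ 2 * (\<Sum>j<h. indet_y ^ (3 * j))"

definition poly_C :: "nat \<Rightarrow> int poly" where
  "poly_C h = indet_y * (\<Sum>j<h. indet_y ^ (3 * j))"

definition T_mat :: "nat \<Rightarrow> int poly mat" where
  "T_mat h = mat_of_rows_list 3
     [[poly_A h, poly_B h, poly_C h],
      [poly_C h, poly_A h, poly_B h],
      [poly_B h, poly_C h, poly_A h]]"

definition v_vec :: "int poly vec" where
  "v_vec = vec_of_list [1, indet_y, indet_y ^ 2]"

definition F_poly :: "nat \<Rightarrow> nat \<Rightarrow> int poly" where
  "F_poly h k = unit_vec 3 0 \<bullet> ((T_mat h ^\<^sub>m k) *\<^sub>v v_vec)"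

(* det (I - z T), computed over Z[y][[z]] with z = fps_X. *)
definition det_I_minus_zT :: "nat \<Rightarrow> int poly fps" where
  "det_I_minus_zT h = det (1\<^sub>m 3 - fps_X \<cdot>\<^sub>m map_mat fps_const (T_mat h))"

(* The library's division of formal power series needs an inverse operation on the
   coefficients, which Z[y] lacks. For a denominator with constant term 1 the quotient
   exists over any commutative ring; see fps_quot_iff. *)
definition fps_quot :: "'a::comm_ring_1 fps \<Rightarrow> 'a fps \<Rightarrow> 'a fps" where
  "fps_quot f g = f * fps_right_inverse g 1"

lemma fps_quot_iff:
  assumes "fps_nth g 0 = 1"
  shows "q = fps_quot f g \<longleftrightarrow> q * g = f"
proof -
  have inv: "g * fps_right_inverse g 1 = 1"
    by (rule fps_right_inverse) (simp add: assms)
  show ?thesis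
  proof
    assume "q = fps_quot f g"
    then have "q * g = f * (g * fps_right_inverse g 1)"
      by (simp add: fps_quot_def mult_ac)
    then show "q * g = f" by (simp add: inv)
  next
    assume "q * g = f"
    then have "f = q * g" by simp
    then have "fps_quot f g = q * (g * fps_right_inverse g 1)"
      by (simp add: fps_quot_def mult.assoc)
    then show "q = fps_quot f g" by (simp add: inv)
  qed
qed

lemma det_I_minus_zT_nth_0: "fps_nth (det_I_minus_zT h) 0 = 1"
proof -
  interpret c: comm_ring_hom "\<lambda>f :: int poly fps. fps_nth f 0"
    by unfold_locales (auto simp: fps_mult_nth_0)
  have "map_mat (\<lambda>f. fps_nth f 0) (1\<^sub>m 3 - fps_X \<cdot>\<^sub>m map_mat fps_const (T_mat h)) = 1\<^sub>m 3"
    by (rule eq_matI) (auto simp: T_mat_def mat_of_rows_list_def)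
  then show ?thesis
    using c.hom_det[of "1\<^sub>m 3 - fps_X \<cdot>\<^sub>m map_mat fps_const (T_mat h)"]
    by (simp add: det_I_minus_zT_def)
qed

end

(* For n = p n' + d with d < p, adding a carry c < 3 to 3 n gives 3 d + c = p c' + r, where
   r < p is a digit, c' < 3 is the next carry, and r = c - c' mod 3 because p = 1 mod 3.
   Summing y^r over the digits in each residue class gives the circulant T, so the vector of
   the sums of y^(s_p (3 n + c)) over n < p^k is T^k v. Its generating function solves
   (I - z T) g = v. By Cramer's rule the numerator of g_0 is a quadratic in z, which
   collapses to (1 - z)^2 because A = 1 + y^3 S, B = y^2 S and C = y S. *)
theory Submission
  imports Defs
begin

section \<open>Digit sums of 3 n + c and the carry recursion\<close>

lemma digit_sum_0 [simp]: "digit_sum b 0 = 0"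
  by (simp add: digit_sum.simps)

lemma digit_sum_mult_add:
  assumes "2 \<le> b" "r < b"
  shows "digit_sum b (b * m + r) = r + digit_sum b m"
  using assms by (subst digit_sum.simps) auto

lemma sum_lessThan_add:
  fixes f :: "nat \<Rightarrow> 'a::comm_monoid_add"
  shows "(\<Sum>i<a + b. f i) = (\<Sum>i<a. f i) + (\<Sum>i<b. f (a + i))"
  by (induction b) (simp_all add: add.assoc)

lemma sum_lessThan_mult:
  fixes f :: "nat \<Rightarrow> 'a::comm_monoid_add"
  shows "(\<Sum>i<a * b. f i) = (\<Sum>i<a. \<Sum>j<b. f (b * i + j))"
  by (induction a) (simp_all add: sum_lessThan_add add.commute[of b] mult.commute[of b])

text \<open>The index c is the carry entering the lowest digit. The wanted sum is the case c = 0,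
  but its recursion in k only closes once c = 1 and c = 2 are included.\<close>

definition carry_sum :: "nat \<Rightarrow> nat \<Rightarrow> nat \<Rightarrow> int poly" where
  "carry_sum p k c = (\<Sum>n<p ^ k. indet_y ^ digit_sum p (3 * n + c))"

lemma carry_sum_0:
  assumes "c < p" "2 \<le> p"
  shows "carry_sum p 0 c = indet_y ^ c"
  using digit_sum_mult_add[of p c 0] assms by (simp add: carry_sum_def)

text \<open>Here d is the lowest base-p digit of the old summation index. The argument is grouped so
  that only 3 d + c remains to be divided by p, and its quotient is the next carry.\<close>

lemma carry_sum_Suc:
  "carry_sum p (Suc k) c
    = (\<Sum>n<p ^ k. \<Sum>d<p. indet_y ^ digit_sum p (p * (3 * n) + (3 * d + c)))"
proof -
  have "carry_sum p (Suc k) c = (\<Sum>n<p ^ k * p. indet_y ^ digit_sum p (3 * n + c))"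
    by (simp add: carry_sum_def mult.commute)
  also have "\<dots> = (\<Sum>n<p ^ k. \<Sum>d<p. indet_y ^ digit_sum p (3 * (p * n + d) + c))"
    by (rule sum_lessThan_mult)
  finally show ?thesis by (simp add: algebra_simps)
qed

lemma poly_A_eq: "poly_A h = (\<Sum>j<Suc h. indet_y ^ (3 * j))"
  by (simp only: poly_A_def atLeast0AtMost lessThan_Suc_atMost)

lemma poly_A_conv: "poly_A h = 1 + indet_y ^ 3 * (\<Sum>j<h. indet_y ^ (3 * j))"
  unfolding poly_A_eq by (subst sum.lessThan_Suc_shift) (simp add: sum_distrib_left power_add)

lemma poly_B_eq: "poly_B h = (\<Sum>j<h. indet_y ^ (3 * j + 2))"
  unfolding poly_B_def sum_distrib_left power_add by (simp only: mult.commute)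

lemma poly_C_eq: "poly_C h = (\<Sum>j<h. indet_y ^ (3 * j + 1))"
  unfolding poly_C_def sum_distrib_left power_add by (simp only: mult.commute power_one_right)

text \<open>This treats a run of digits d with a common outgoing carry c', where \<open>t j\<close>
  is 3 d + c for the j-th of them. As 3 j + e < p, it is the lowest digit of the argument; peeling
  it off leaves 3 n + c'.\<close>

lemma sum_digits:
  fixes p c' e l :: nat
  assumes "2 \<le> p" and "\<And>j. j < l \<Longrightarrow> t j = p * c' + (3 * j + e) \<and> 3 * j + e < p"
  shows "(\<Sum>j<l. indet_y ^ digit_sum p (p * (3 * n) + t j))
    = (\<Sum>j<l. indet_y ^ (3 * j + e)) * indet_y ^ digit_sum p (3 * n + c')"
  unfolding sum_distrib_right
proof (rule sum.cong[OF refl])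
  fix j assume "j \<in> {..<l}"
  then have t: "t j = p * c' + (3 * j + e)" and lt: "3 * j + e < p" using assms(2) by auto
  have "digit_sum p (p * (3 * n) + t j) = digit_sum p (p * (3 * n + c') + (3 * j + e))"
    unfolding t by (simp only: distrib_left add.assoc)
  also have "\<dots> = 3 * j + e + digit_sum p (3 * n + c')"
    using assms(1) lt by (rule digit_sum_mult_add)
  finally show "indet_y ^ digit_sum p (p * (3 * n) + t j)
      = indet_y ^ (3 * j + e) * indet_y ^ digit_sum p (3 * n + c')"
    by (simp only: power_add)
qed

text \<open>As d grows, the quotient of 3 d + c by p runs through 0, 1, 2, so the digits d < p form
  three consecutive runs. The run whose remainders are 0, 2 or 1 mod 3 contributes A, B or C; the A
  run has h + 1 digits, the others h.\<close>

lemma carry_sum_rec: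
  assumes p: "p = 3 * h + 1" "2 \<le> p"
  shows "carry_sum p (Suc k) 0 = poly_A h * carry_sum p k 0 + poly_B h * carry_sum p k 1
      + poly_C h * carry_sum p k 2"
    and "carry_sum p (Suc k) 1 = poly_C h * carry_sum p k 0 + poly_A h * carry_sum p k 1
      + poly_B h * carry_sum p k 2"
    and "carry_sum p (Suc k) 2 = poly_B h * carry_sum p k 0 + poly_C h * carry_sum p k 1
      + poly_A h * carry_sum p k 2"
proof -
  let ?f = "\<lambda>n t. indet_y ^ digit_sum p (p * (3 * n) + t)"
  let ?g = "\<lambda>n c. indet_y ^ digit_sum p (3 * n + c)"
  have A: "(\<Sum>j<Suc h. ?f n (t j)) = poly_A h * ?g n c'"
    if "\<And>j. j < Suc h \<Longrightarrow> t j = p * c' + 3 * j" for n c' t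
    using sum_digits[of p "Suc h" t c' 0 n] that p by (simp only: poly_A_eq) force
  have B: "(\<Sum>j<h. ?f n (t j)) = poly_B h * ?g n c'"
    if "\<And>j. j < h \<Longrightarrow> t j = p * c' + (3 * j + 2)" for n c' t
    using sum_digits[of p h t c' 2 n] that p by (simp only: poly_B_eq) force
  have C: "(\<Sum>j<h. ?f n (t j)) = poly_C h * ?g n c'"
    if "\<And>j. j < h \<Longrightarrow> t j = p * c' + (3 * j + 1)" for n c' t
    using sum_digits[of p h t c' 1 n] that p by (simp only: poly_C_eq) force
  have split: "(\<Sum>d<p. f d) = (\<Sum>d<a. f d) + (\<Sum>d<b. f (a + d)) + (\<Sum>d<c. f (a + b + d))"
    if "a + b + c = p" for a b c and f :: "nat \<Rightarrow> int poly"
    unfolding that[symmetric] sum_lessThan_add ..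
  \<comment> \<open>These rewrites bring both sides to a single sum over n, so that the identity can
    be checked for each n separately.\<close>
  note rec = carry_sum_Suc carry_sum_def[of p k] sum_distrib_left sum.distrib[symmetric]
  \<comment> \<open>For d = j, h + 1 + j, 2 h + 1 + j the value 3 d is 3 j, p + (3 j + 2), 2 p + (3
    j + 1).\<close>
  show "carry_sum p (Suc k) 0 = poly_A h * carry_sum p k 0 + poly_B h * carry_sum p k 1
      + poly_C h * carry_sum p k 2"
    unfolding rec
    by (intro sum.cong refl, subst split[of "Suc h" h h], (use p in simp),
        rule arg_cong2[of _ _ _ _ "(+)", OF arg_cong2[of _ _ _ _ "(+)", OF A B] C])
      (use p in auto)
  \<comment> \<open>For d = j, h + j, 2 h + 1 + j the value 3 d + 1 is 3 j + 1, p + 3 j, 2 p + (3 j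
    + 2).\<close>
  show "carry_sum p (Suc k) 1 = poly_C h * carry_sum p k 0 + poly_A h * carry_sum p k 1
      + poly_B h * carry_sum p k 2"
    unfolding rec
    by (intro sum.cong refl, subst split[of h "Suc h" h], (use p in simp),
        rule arg_cong2[of _ _ _ _ "(+)", OF arg_cong2[of _ _ _ _ "(+)", OF C A] B])
      (use p in auto)
  \<comment> \<open>For d = j, h + j, 2 h + j the value 3 d + 2 is 3 j + 2, p + (3 j + 1), 2 p + 3
    j.\<close>
  show "carry_sum p (Suc k) 2 = poly_B h * carry_sum p k 0 + poly_C h * carry_sum p k 1
      + poly_A h * carry_sum p k 2"
    unfolding rec
    by (intro sum.cong refl, subst split[of h h "Suc h"], (use p in simp),
        rule arg_cong2[of _ _ _ _ "(+)", OF arg_cong2[of _ _ _ _ "(+)", OF B C] A])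
      (use p in auto)
qed

section \<open>Powers of T applied to v\<close>

lemma T_mat_carrier [simp]: "T_mat h \<in> carrier_mat 3 3"
  by (rule carrier_matI) (simp_all add: T_mat_def mat_of_rows_list_def)

lemma v_vec_carrier [simp]: "v_vec \<in> carrier_vec 3"
  by (simp add: v_vec_def carrier_vecI)

lemma T_mat_mult_vec:
  "T_mat h *\<^sub>v vec 3 g = vec_of_list
    [poly_A h * g 0 + poly_B h * g 1 + poly_C h * g 2,
     poly_C h * g 0 + poly_A h * g 1 + poly_B h * g 2,
     poly_B h * g 0 + poly_C h * g 1 + poly_A h * g 2]"
  by (rule eq_vecI)
    (auto simp: T_mat_def mat_of_rows_list_def scalar_prod_def numeral_3_eq_3 less_Suc_eq
      vec_of_list_index numeral_2_eq_2 add.assoc)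

text \<open>The recursion of \<open>^\<^sub>m\<close> adds the new factor on the right, whereas the
  carry recursion applies T last, hence on the left.\<close>

lemma pow_mat_Suc_left:
  assumes "A \<in> carrier_mat n n"
  shows "A ^\<^sub>m Suc k = A * A ^\<^sub>m k"
proof (induction k)
  case 0
  show ?case using assms by simp
next
  case (Suc k)
  have "A ^\<^sub>m Suc (Suc k) = (A * A ^\<^sub>m k) * A" using Suc by simp
  also have "\<dots> = A * (A ^\<^sub>m k * A)"
    using assms by (intro assoc_mult_mat[of _ n n _ n _ n]) auto
  finally show ?case by simp
qed

lemma T_mat_pow_mult_v_vec:
  assumes p: "p = 3 * h + 1" "2 \<le> p"
  shows "(T_mat h ^\<^sub>m k) *\<^sub>v v_vec = vec 3 (carry_sum p k)"
proof (induction k)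
  case 0
  \<comment> \<open>From p = 3 h + 1 and p \<ge> 2 follows p \<ge> 4, so each carry below 3 is a
    single digit and the initial vector is v.\<close>
  have "carry_sum p 0 i = indet_y ^ i" if "i < 3" for i
    using carry_sum_0[of i p] p that by simp
  then have "vec 3 (carry_sum p 0) = vec 3 (\<lambda>i. indet_y ^ i)"
    by (intro eq_vecI) simp_all
  also have "\<dots> = v_vec"
    by (rule eq_vecI)
      (auto simp: v_vec_def vec_of_list_index less_Suc_eq numeral_3_eq_3 numeral_2_eq_2)
  finally have "v_vec = vec 3 (carry_sum p 0)" ..
  moreover have "dim_row (T_mat h) = 3"
    using T_mat_carrier by blast
  ultimately show ?case by simp
next
  case (Suc k)
  have "T_mat h ^\<^sub>m Suc k = T_mat h * T_mat h ^\<^sub>m k"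
    by (rule pow_mat_Suc_left[OF T_mat_carrier])
  then have "(T_mat h ^\<^sub>m Suc k) *\<^sub>v v_vec = T_mat h *\<^sub>v ((T_mat h ^\<^sub>m k) *\<^sub>v v_vec)"
    by (metis T_mat_carrier v_vec_carrier pow_carrier_mat assoc_mult_mat_vec)
  also have "\<dots> = vec 3 (carry_sum p (Suc k))"
    unfolding Suc T_mat_mult_vec carry_sum_rec[OF p, symmetric]
    by (rule eq_vecI) (auto simp: vec_of_list_index less_Suc_eq numeral_3_eq_3 numeral_2_eq_2)
  finally show ?case .
qed

lemma F_poly_eq_carry_sum:
  assumes "p = 3 * h + 1" "2 \<le> p"
  shows "F_poly h k = carry_sum p k 0"
  unfolding F_poly_def T_mat_pow_mult_v_vec[OF assms]
  by (subst scalar_prod_left_unit) auto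

section \<open>The determinant of I - z T\<close>

lemma det_2x2:
  fixes M :: "'a::comm_ring_1 mat"
  assumes "M \<in> carrier_mat 2 2"
  shows "det M = M $$ (0,0) * M $$ (1,1) - M $$ (0,1) * M $$ (1,0)"
  unfolding laplace_expansion_row[OF assms, of 0, simplified]
  using assms by (simp add: numeral_2_eq_2 cofactor_def det_single mat_delete_def)

lemma det_3x3:
  fixes M :: "'a::comm_ring_1 mat"
  assumes "M \<in> carrier_mat 3 3"
  shows "det M =
    M $$ (0,0) * (M $$ (1,1) * M $$ (2,2) - M $$ (1,2) * M $$ (2,1))
    - M $$ (0,1) * (M $$ (1,0) * M $$ (2,2) - M $$ (1,2) * M $$ (2,0))
    + M $$ (0,2) * (M $$ (1,0) * M $$ (2,1) - M $$ (1,1) * M $$ (2,0))"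
  unfolding laplace_expansion_row[OF assms, of 0, simplified]
  using assms
  by (simp add: numeral_3_eq_3 numeral_2_eq_2 cofactor_def det_2x2[unfolded numeral_2_eq_2] mat_delete_def algebra_simps)

text \<open>The left side is the cofactor expansion along the first row. On the right, a + b + c is
  the eigenvalue at (1,1,1), and the quadratic factor is the product of 1 - z (a + b w + c w^2) over
  the two primitive cube roots of unity w.\<close>

lemma circulant_det_factor:
  fixes z a b c :: "'a::comm_ring_1"
  shows "(1 - z * a) * ((1 - z * a) * (1 - z * a) - (- z * b) * (- z * c))
    - (- z * b) * ((- z * c) * (1 - z * a) - (- z * b) * (- z * b))
    + (- z * c) * ((- z * c) * (- z * c) - (1 - z * a) * (- z * b))
    = (1 - z * (a + b + c)) *
      (1 - z * (a + a - b - c) + z ^ 2 * (a^2 + b^2 + c^2 - a * b - a * c - b * c))"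
  by (simp add: power2_eq_square algebra_simps)

lemma det_I_minus_zT_fps_const:
  fixes h :: nat
  defines "a \<equiv> fps_const (poly_A h)" and "b \<equiv> fps_const (poly_B h)" and "c \<equiv> fps_const (poly_C h)"
  shows "det_I_minus_zT h = (1 - fps_X * (a + b + c)) *
    (1 - fps_X * (a + a - b - c) + fps_X ^ 2 * (a^2 + b^2 + c^2 - a * b - a * c - b * c))"
proof -
  let ?M = "1\<^sub>m 3 - fps_X \<cdot>\<^sub>m map_mat fps_const (T_mat h)"
  have M: "?M \<in> carrier_mat 3 3"
    by (intro minus_carrier_mat smult_carrier_mat map_carrier_mat[THEN iffD2] T_mat_carrier)
  have entries: "?M $$ (0,0) = 1 - fps_X * a" "?M $$ (0,1) = - fps_X * b" "?M $$ (0,2) = - fps_X * c"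
    "?M $$ (1,0) = - fps_X * c" "?M $$ (1,1) = 1 - fps_X * a" "?M $$ (1,2) = - fps_X * b"
    "?M $$ (2,0) = - fps_X * b" "?M $$ (2,1) = - fps_X * c" "?M $$ (2,2) = 1 - fps_X * a"
    by (auto simp: T_mat_def mat_of_rows_list_def a_def b_def c_def)
  show ?thesis
    unfolding det_I_minus_zT_def det_3x3[OF M] entries by (rule circulant_det_factor)
qed

lemma det_I_minus_zT_eq:
  "det_I_minus_zT h =
    (1 - fps_X * fps_const (poly_A h + poly_B h + poly_C h)) *
    (1 - fps_X * fps_const (2 * poly_A h - poly_B h - poly_C h)
       + fps_X ^ 2 * fps_const ((poly_A h)^2 + (poly_B h)^2 + (poly_C h)^2
           - poly_A h * poly_B h - poly_A h * poly_C h - poly_B h * poly_C h))"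
  unfolding det_I_minus_zT_fps_const
  by (simp only: mult_2 power2_eq_square fps_const_add fps_const_sub fps_const_mult)

section \<open>The generating function by Cramer's rule\<close>

lemma circulant_resolvent:
  fixes y s z g0 g1 g2 :: "'a::comm_ring_1"
  assumes abc: "a = 1 + y^3 * s" "b = y^2 * s" "c = y * s"
    and g0: "g0 = 1 + z * (a * g0 + b * g1 + c * g2)"
    and g1: "g1 = y + z * (c * g0 + a * g1 + b * g2)"
    and g2: "g2 = y^2 + z * (b * g0 + c * g1 + a * g2)"
  shows "g0 * ((1 - z * (a + b + c)) *
    (1 - z * (a + a - b - c) + z^2 * (a^2 + b^2 + c^2 - a * b - a * c - b * c))) = (1 - z)^2"
    (is "?L = _")
proof -
  \<comment> \<open>The multipliers are the cofactors of the first column of I - z T. Combining the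
    three equations with them cancels g1 and g2 and leaves g0 times the determinant.\<close>
  have "?L = ((1 - z * a)^2 - z^2 * b * c) * (g0 - z * (a * g0 + b * g1 + c * g2))
    + (z * b * (1 - z * a) + z^2 * c^2) * (g1 - z * (c * g0 + a * g1 + b * g2))
    + (z * c * (1 - z * a) + z^2 * b^2) * (g2 - z * (b * g0 + c * g1 + a * g2))"
    by (simp add: power2_eq_square algebra_simps)
  also have "g0 - z * (a * g0 + b * g1 + c * g2) = 1" using g0 by (simp only: diff_eq_eq)
  also have "g1 - z * (c * g0 + a * g1 + b * g2) = y" using g1 by (simp only: diff_eq_eq)
  also have "g2 - z * (b * g0 + c * g1 + a * g2) = y^2" using g2 by (simp only: diff_eq_eq)
  \<comment> \<open>After substituting for a, b and c, every term containing s cancels.\<close>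
  also have "((1 - z * a)^2 - z^2 * b * c) * 1 + (z * b * (1 - z * a) + z^2 * c^2) * y
    + (z * c * (1 - z * a) + z^2 * b^2) * y^2 = (1 - z)^2"
    unfolding abc by (simp add: power2_eq_square power3_eq_cube algebra_simps)
  finally show ?thesis .
qed

text \<open>Multiplication by \<open>fps_X\<close> shifts the index by one, so a coefficient
  recurrence becomes a linear equation between series.\<close>

lemma Abs_fps_recurrence:
  fixes f g1 g2 g3 :: "nat \<Rightarrow> 'a::comm_ring_1"
  assumes "f 0 = x" "\<And>k. f (Suc k) = a * g1 k + b * g2 k + c * g3 k"
  shows "Abs_fps f = fps_const x + fps_X *
    (fps_const a * Abs_fps g1 + fps_const b * Abs_fps g2 + fps_const c * Abs_fps g3)"
proof (rule fps_ext)
  fix k show "fps_nth (Abs_fps f) k = fps_nth (fps_const x + fps_X *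
    (fps_const a * Abs_fps g1 + fps_const b * Abs_fps g2 + fps_const c * Abs_fps g3)) k"
    using assms by (cases k) simp_all
qed

lemma carry_sum_fps_mult_det:
  assumes p: "p = 3 * h + 1" "2 \<le> p"
  shows "Abs_fps (\<lambda>k. carry_sum p k 0) * det_I_minus_zT h = (1 - fps_X) ^ 2"
proof -
  let ?c = "fps_const :: int poly \<Rightarrow> int poly fps"
  let ?S = "\<Sum>j<h. indet_y ^ (3 * j)"
  let ?A = "poly_A h" and ?B = "poly_B h" and ?C = "poly_C h"
  have 0: "carry_sum p 0 0 = 1" "carry_sum p 0 1 = indet_y" "carry_sum p 0 2 = indet_y ^ 2"
    using p by (simp_all add: carry_sum_0)
  have abc: "?c ?A = 1 + ?c indet_y ^ 3 * ?c ?S" "?c ?B = ?c indet_y ^ 2 * ?c ?S"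
    "?c ?C = ?c indet_y * ?c ?S"
    by (simp_all only: poly_A_conv poly_B_def poly_C_def fps_const_power fps_const_mult
        fps_const_add flip: fps_const_1_eq_1)
  note sys = Abs_fps_recurrence[of "\<lambda>k. carry_sum p k 0", OF 0(1) carry_sum_rec(1)[OF p]]
    Abs_fps_recurrence[of "\<lambda>k. carry_sum p k 1", OF 0(2) carry_sum_rec(2)[OF p]]
    Abs_fps_recurrence[of "\<lambda>k. carry_sum p k 2", OF 0(3) carry_sum_rec(3)[OF p]]
  show ?thesis
    unfolding det_I_minus_zT_fps_const
    using sys by (intro circulant_resolvent[OF abc]) (simp_all only: fps_const_1_eq_1 fps_const_power)
qed

theorem proposition7p1:
  fixes p h :: nat
  assumes "prime p" and "[p = 1] (mod 3)" and "p = 3 * h + 1"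
  shows "(\<forall>k. F_poly h k = (\<Sum>n<p ^ k. indet_y ^ digit_sum p (3 * n)))
    \<and> Abs_fps (\<lambda>k. F_poly h k) = fps_quot ((1 - fps_X) ^ 2) (det_I_minus_zT h)
    \<and> det_I_minus_zT h =
        (1 - fps_X * fps_const (poly_A h + poly_B h + poly_C h)) *
        (1 - fps_X * fps_const (2 * poly_A h - poly_B h - poly_C h)
           + fps_X ^ 2 * fps_const ((poly_A h)^2 + (poly_B h)^2 + (poly_C h)^2
               - poly_A h * poly_B h - poly_A h * poly_C h - poly_B h * poly_C h))"
proof (intro conjI allI)
  note p = assms(3) prime_ge_2_nat[OF assms(1)]
  show "F_poly h k = (\<Sum>n<p ^ k. indet_y ^ digit_sum p (3 * n))" for k
    by (simp add: F_poly_eq_carry_sum[OF p] carry_sum_def)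
  \<comment> \<open>The determinant has constant term 1, so the quotient claim is equivalent to the
    product identity for the carry-0 series.\<close>
  show "Abs_fps (\<lambda>k. F_poly h k) = fps_quot ((1 - fps_X) ^ 2) (det_I_minus_zT h)"
    unfolding F_poly_eq_carry_sum[OF p] fps_quot_iff[OF det_I_minus_zT_nth_0]
    by (rule carry_sum_fps_mult_det[OF p])
qed (rule det_I_minus_zT_eq)

end
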